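(* The logic $\mathrm{PL}_{\vee}(\mathrm{NE})$ is expressively complete for the class of all convex and union-closed properties: for every finite $\mathsf X\subseteq\mathsf P$, the set $\{\|\varphi\|_{\mathsf X}:\varphi\in\mathrm{PL}_{\vee}(\mathrm{NE}) \text{ with all letters in }\mathsf X\}$ is exactly the set of all convex and union-closed properties over $\mathsf X$.
   Context: Fix a countably infinite set $\mathsf P$ of propositional letters. For $\mathsf X\subseteq\mathsf P$, a team over $\mathsf X$ is a set $t\subseteq 2^{\mathsf X}$ of valuations $v:\mathsf X\to\{0,1\}$. Classical formulas $\mathrm{PL}_{\vee}$: $\alpha::=p\mid\bot\mid\alpha\wedge\alpha\mid\alpha\vee\alpha\mid\neg\alpha$. Formulas of $\mathrm{PL}_{\vee}(\mathrm{NE})$: $\varphi::=p\mid\bot\mid\varphi\wedge\varphi\mid\varphi\vee\varphi\mid\neg\alpha\mid\mathrm{NE}$ with $\alpha\in\mathrm{PL}_\vee$. Truth in a team $t$ over $\mathsf X$ (letters in $\mathsf X$): $t\models p$ iff $v(p)=1$ for all $v\in t$; $t\models\bot$ iff $t=\emptyset$; $t\models\neg\alpha$ iff $\{v\}\not\models\alpha$ for all $v\in t$; $t\models\varphi\wedge\psi$ iff both hold; $t\models\varphi\vee\psi$ iff there are $s,u$ with $s\models\varphi$, $u\models\psi$ and $t=s\cup u$; $t\models\mathrm{NE}$ iff $t\neq\emptyset$. A property over $\mathsf X$ is a set of teams over $\mathsf X$; $\|\varphi\|_{\mathsf X}:=\{t\subseteq2^{\mathsf X}:t\models\varphi\}$.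 A property $\mathcal P$ is convex if $s,t\in\mathcal P$ and $s\subseteq u\subseteq t$ imply $u\in\mathcal P$; it is union closed if for every nonempty $\mathcal T\subseteq\mathcal P$, $\bigcup\mathcal T\in\mathcal P$. *)

theory Defs
  imports Main "HOL-Library.FuncSet" "HOL-Library.Countable_Set"
begin

datatype (letters: 'p) fm =
    Letter 'p
  | Bot
  | Conj "'p fm" "'p fm"
  | Disj "'p fm" "'p fm"
  | Neg "'p fm"
  | NE

text \<open>The type above is the raw syntax shared by both languages; the two grammars
  are the following sets. Negation applies to classical formulas only.\<close>

inductive_set PL :: "'p fm set" where
  "Letter p \<in> PL"
| "Bot \<in> PL"
| "\<alpha> \<in> PL \<Longrightarrow> \<beta> \<in> PL \<Longrightarrow> Conj \<alpha> \<beta> \<in> PL"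
| "\<alpha> \<in> PL \<Longrightarrow> \<beta> \<in> PL \<Longrightarrow> Disj \<alpha> \<beta> \<in> PL"
| "\<alpha> \<in> PL \<Longrightarrow> Neg \<alpha> \<in> PL"

inductive_set PL_NE :: "'p fm set" where
  "Letter p \<in> PL_NE"
| "Bot \<in> PL_NE"
| "\<phi> \<in> PL_NE \<Longrightarrow> \<psi> \<in> PL_NE \<Longrightarrow> Conj \<phi> \<psi> \<in> PL_NE"
| "\<phi> \<in> PL_NE \<Longrightarrow> \<psi> \<in> PL_NE \<Longrightarrow> Disj \<phi> \<psi> \<in> PL_NE"
| "\<alpha> \<in> PL \<Longrightarrow> Neg \<alpha> \<in> PL_NE"
| "NE \<in> PL_NE"

text \<open>Valuations over \<open>X\<close> are functions from \<open>X\<close> to truth values. They are taken to be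
  extensional, so that two valuations are equal as soon as they agree on \<open>X\<close>.\<close>

definition valuations :: "'p set \<Rightarrow> ('p \<Rightarrow> bool) set" where
  "valuations X = X \<rightarrow>\<^sub>E UNIV"

definition teams :: "'p set \<Rightarrow> ('p \<Rightarrow> bool) set set" where
  "teams X = Pow (valuations X)"

text \<open>In the clause for disjunction \<open>s\<close> and \<open>u\<close> are subsets of \<open>t\<close>, hence teams over
  the same set of letters as \<open>t\<close>.\<close>

primrec sat :: "('p \<Rightarrow> bool) set \<Rightarrow> 'p fm \<Rightarrow> bool" where
  "sat t (Letter p) \<longleftrightarrow> (\<forall>v\<in>t. v p)"
| "sat t Bot \<longleftrightarrow> t = {}"
| "sat t (Conj \<phi> \<psi>) \<longleftrightarrow> sat t \<phi> \<and> sat t \<psi>"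
| "sat t (Disj \<phi> \<psi>) \<longleftrightarrow> (\<exists>s u. sat s \<phi> \<and> sat u \<psi> \<and> t = s \<union> u)"
| "sat t (Neg \<alpha>) \<longleftrightarrow> (\<forall>v\<in>t. \<not> sat {v} \<alpha>)"
| "sat t NE \<longleftrightarrow> t \<noteq> {}"

definition extension :: "'p set \<Rightarrow> 'p fm \<Rightarrow> ('p \<Rightarrow> bool) set set" where
  "extension X \<phi> = {t \<in> teams X. sat t \<phi>}"

definition convex_property :: "'v set set \<Rightarrow> bool" where
  "convex_property Q \<longleftrightarrow> (\<forall>s u t. s \<in> Q \<longrightarrow> t \<in> Q \<longrightarrow> s \<subseteq> u \<longrightarrow> u \<subseteq> t \<longrightarrow> u \<in> Q)"

definition union_closed :: "'v set set \<Rightarrow> bool" where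
  "union_closed Q \<longleftrightarrow> (\<forall>T. T \<subseteq> Q \<longrightarrow> T \<noteq> {} \<longrightarrow> \<Union>T \<in> Q)"

end

theory Submission
  imports Defs
begin

text \<open>Soundness is an induction on formulas. For completeness, let \<open>Q\<close> be nonempty, convex and
  union closed, and let \<open>m = \<Union>Q\<close>, the largest team of \<open>Q\<close>. A team \<open>t\<close> belongs to \<open>Q\<close> iff
  \<open>t \<subseteq> m\<close> and \<open>t\<close> meets every set \<open>c\<close> of valuations that meets all teams of \<open>Q\<close>: if \<open>t \<subseteq> m\<close>
  contains no team of \<open>Q\<close>, then \<open>c = m - t\<close> meets all of them but not \<open>t\<close>. The first condition is
  expressed by a classical formula for \<open>m\<close>, the second by the conjunction over all such \<open>c\<close> of
  \<open>(NE \<and> \<chi>\<^sub>c) \<or> \<not>\<bottom>\<close>, where \<open>\<chi>\<^sub>c\<close> is a classical formula for \<open>c\<close>.\<close>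

text \<open>In the case of \<open>Disj\<close>, each team of the family is split separately, and all
  left halves and all right halves are then united. Nonemptiness of the family matters for
  \<open>NE\<close>, which fails in the empty union.\<close>

lemma sat_Union:
  assumes "T \<noteq> {}" and "\<And>t. t \<in> T \<Longrightarrow> sat t \<phi>"
  shows "sat (\<Union>T) \<phi>"
  using assms
proof (induction \<phi> arbitrary: T)
  case (Disj \<phi> \<psi>)
  have "\<forall>t\<in>T. \<exists>s u. sat s \<phi> \<and> sat u \<psi> \<and> t = s \<union> u"
    using Disj.prems(2) by simp
  then obtain f g where fg: "\<And>t. t \<in> T \<Longrightarrow> sat (f t) \<phi> \<and> sat (g t) \<psi> \<and> t = f t \<union> g t"
    by metis
  have "sat (\<Union>(f ` T)) \<phi>"
    by (rule Disj.IH(1)) (use Disj.prems(1) fg in auto)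
  moreover have "sat (\<Union>(g ` T)) \<psi>"
    by (rule Disj.IH(2)) (use Disj.prems(1) fg in auto)
  moreover have "\<Union>T = \<Union>(f ` T) \<union> \<Union>(g ` T)"
    using fg by blast
  ultimately show ?case by auto
qed auto

lemma sat_Un: "sat s \<phi> \<Longrightarrow> sat t \<phi> \<Longrightarrow> sat (s \<union> t) \<phi>"
  using sat_Union[of "{s, t}" \<phi>] by auto

lemma sat_convex:
  assumes "sat s \<phi>" and "sat t \<phi>" and "s \<subseteq> u" and "u \<subseteq> t"
  shows "sat u \<phi>"
  using assms
proof (induction \<phi> arbitrary: s t u)
  case (Disj \<phi> \<psi>)
  obtain s1 s2 where s: "sat s1 \<phi>" "sat s2 \<psi>" "s = s1 \<union> s2"
    using Disj.prems(1) by auto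
  obtain t1 t2 where t: "sat t1 \<phi>" "sat t2 \<psi>" "t = t1 \<union> t2"
    using Disj.prems(2) by auto
  \<comment> \<open>Intersecting \<open>u\<close> with \<open>t1\<close> alone could lose every
    subteam known to satisfy \<open>\<phi>\<close>. Adding \<open>s1\<close> gives a set between
    \<open>s1\<close> and \<open>s1 \<union> t1\<close>; the upper end satisfies
    \<open>\<phi>\<close> by union closure, so the induction hypothesis applies.\<close>
  have "sat (u \<inter> (s1 \<union> t1)) \<phi>"
    by (rule Disj.IH(1)[OF s(1) sat_Un[OF s(1) t(1)]]) (use s(3) Disj.prems(3) in auto)
  moreover have "sat (u \<inter> (s2 \<union> t2)) \<psi>"
    by (rule Disj.IH(2)[OF s(2) sat_Un[OF s(2) t(2)]]) (use s(3) Disj.prems(3) in auto)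
  moreover have "u = u \<inter> (s1 \<union> t1) \<union> u \<inter> (s2 \<union> t2)"
    using t(3) Disj.prems(4) by auto
  ultimately show ?case unfolding sat.simps(4) by (intro exI conjI)
next
  case (Conj \<phi> \<psi>)
  from Conj.prems show ?case
    using Conj.IH(1)[of s t u] Conj.IH(2)[of s t u] by simp
next
  case (Letter p)
  then show ?case by auto
next
  case (Neg \<alpha>)
  then show ?case by (simp add: subset_iff)
next
  case NE
  then show ?case by auto
next
  case Bot
  then show ?case by simp
qed

lemma convex_extension: "convex_property (extension X \<phi>)"
  unfolding convex_property_def extension_def teams_def
  using sat_convex by blast

lemma union_closed_extension: "union_closed (extension X \<phi>)"
  unfolding union_closed_def
proof (intro allI impI)
  fix T assume T: "T \<subseteq> extension X \<phi>" "T \<noteq> {}"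
  then have "sat (\<Union>T) \<phi>"
    by (intro sat_Union) (auto simp: extension_def)
  with T show "\<Union>T \<in> extension X \<phi>"
    by (auto simp: extension_def teams_def)
qed

lemma finite_valuations: "finite X \<Longrightarrow> finite (valuations X)"
  unfolding valuations_def by (intro finite_PiE) auto

text \<open>The witness is the conjunction of the literals true under \<open>v\<close>, starting
  from the empty conjunction \<open>Neg Bot\<close>.\<close>

lemma PL_agreement_formula:
  assumes "finite Y"
  shows "\<exists>\<alpha>\<in>PL. letters \<alpha> \<subseteq> Y \<and> (\<forall>w. sat {w} \<alpha> \<longleftrightarrow> (\<forall>p\<in>Y. w p = v p))"
  using assms
proof induction
  case empty
  have "Neg Bot \<in> PL" by (intro PL.intros)
  then show ?case by force
next
  case (insert p Y)
  then obtain \<alpha> where \<alpha>: "\<alpha> \<in> PL" "letters \<alpha> \<subseteq> Y"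
    "\<And>w. sat {w} \<alpha> \<longleftrightarrow> (\<forall>p\<in>Y. w p = v p)" by blast
  let ?\<beta> = "Conj (if v p then Letter p else Neg (Letter p)) \<alpha>"
  have "?\<beta> \<in> PL" using \<alpha>(1) by (auto intro: PL.intros)
  moreover have "letters ?\<beta> \<subseteq> insert p Y" using \<alpha>(2) by auto
  moreover have "sat {w} ?\<beta> \<longleftrightarrow> (\<forall>q\<in>insert p Y. w q = v q)" for w
    using \<alpha>(3) by auto
  ultimately show ?case by blast
qed

text \<open>This is disjunctive normal form: the formula for \<open>c\<close> is built from the
  agreement formulas of its members. Singletons suffice because \<open>Neg\<close> evaluates its
  argument only on them.\<close>

lemma PL_singleton_complete:
  assumes "finite X" and "c \<subseteq> valuations X"
  shows "\<exists>\<alpha>\<in>PL. letters \<alpha> \<subseteq> X \<and> (\<forall>w\<in>valuations X. sat {w} \<alpha> \<longleftrightarrow> w \<in> c)"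
proof -
  have "finite c" using assms finite_valuations finite_subset by blast
  then show ?thesis using assms(2)
  proof induction
    case empty
    show ?case using PL.intros(2) by (intro bexI[of _ Bot]) auto
  next
    case (insert v c)
    obtain \<alpha> where \<alpha>: "\<alpha> \<in> PL" "letters \<alpha> \<subseteq> X"
      "\<And>w. sat {w} \<alpha> \<longleftrightarrow> (\<forall>p\<in>X. w p = v p)"
      using PL_agreement_formula[OF assms(1), of v] by metis
    obtain \<beta> where \<beta>: "\<beta> \<in> PL" "letters \<beta> \<subseteq> X"
      "\<And>w. w \<in> valuations X \<Longrightarrow> sat {w} \<beta> \<longleftrightarrow> w \<in> c"
      using insert by auto
    have eq: "(\<forall>p\<in>X. w p = v p) \<longleftrightarrow> w = v" if "w \<in> valuations X" for w
    proof
      assume "\<forall>p\<in>X. w p = v p"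
      moreover have "v \<in> valuations X" using insert.prems by simp
      ultimately show "w = v"
        using PiE_ext[of w X "\<lambda>_. UNIV" v] that by (simp add: valuations_def)
    qed simp
    \<comment> \<open>The De Morgan dual replaces \<open>Disj\<close>, whose clause on singletons also involves the empty team.\<close>
    let ?\<gamma> = "Neg (Conj (Neg \<alpha>) (Neg \<beta>))"
    have "?\<gamma> \<in> PL" using \<alpha>(1) \<beta>(1) by (intro PL.intros)
    moreover have "letters ?\<gamma> \<subseteq> X" using \<alpha>(2) \<beta>(2) by simp
    moreover have "sat {w} ?\<gamma> \<longleftrightarrow> w \<in> insert v c" if "w \<in> valuations X" for w
      using that \<alpha>(3) \<beta>(3) eq by simp
    ultimately show ?case by blast
  qed
qed

lemma PL_NE_subteam_formula:
  assumes "finite X" and "c \<subseteq> valuations X"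
  shows "\<exists>\<phi>\<in>PL_NE. letters \<phi> \<subseteq> X \<and> (\<forall>t\<in>teams X. sat t \<phi> \<longleftrightarrow> t \<subseteq> c)"
proof -
  \<comment> \<open>Negating a formula for the complement of \<open>c\<close> turns the condition on
    singletons into one on every member of a team.\<close>
  obtain \<alpha> where \<alpha>: "\<alpha> \<in> PL" "letters \<alpha> \<subseteq> X"
    "\<forall>w\<in>valuations X. sat {w} \<alpha> \<longleftrightarrow> w \<in> valuations X - c"
    using PL_singleton_complete[OF assms(1), of "valuations X - c"] by blast
  have "sat t (Neg \<alpha>) \<longleftrightarrow> t \<subseteq> c" if "t \<in> teams X" for t
    using that \<alpha>(3) by (auto simp: teams_def)
  moreover have "Neg \<alpha> \<in> PL_NE" using \<alpha>(1) by (rule PL_NE.intros)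
  ultimately show ?thesis using \<alpha>(2) by (intro bexI[of _ "Neg \<alpha>"]) auto
qed

lemma PL_NE_meets_formula:
  assumes "finite X" and "c \<subseteq> valuations X"
  shows "\<exists>\<phi>\<in>PL_NE. letters \<phi> \<subseteq> X \<and> (\<forall>t\<in>teams X. sat t \<phi> \<longleftrightarrow> t \<inter> c \<noteq> {})"
proof -
  obtain \<chi> where \<chi>: "\<chi> \<in> PL_NE" "letters \<chi> \<subseteq> X"
    "\<And>t. t \<in> teams X \<Longrightarrow> sat t \<chi> \<longleftrightarrow> t \<subseteq> c"
    using PL_NE_subteam_formula[OF assms] by blast
  let ?\<phi> = "Disj (Conj NE \<chi>) (Neg Bot)"
  have "sat t ?\<phi> \<longleftrightarrow> t \<inter> c \<noteq> {}" if t: "t \<in> teams X" for t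
  proof
    assume "sat t ?\<phi>"
    then obtain s where s: "s \<noteq> {}" "sat s \<chi>" "s \<subseteq> t" by auto
    moreover have "s \<in> teams X" using s(3) t by (auto simp: teams_def)
    ultimately show "t \<inter> c \<noteq> {}" using \<chi>(3) by blast
  next
    assume "t \<inter> c \<noteq> {}"
    moreover have "sat (t \<inter> c) \<chi>"
      using \<chi>(3)[of "t \<inter> c"] t by (auto simp: teams_def)
    \<comment> \<open>The two parts of a split may overlap, and \<open>Neg Bot\<close> holds in
      every team, so all of \<open>t\<close> can serve as the second part.\<close>
    ultimately have "sat (t \<inter> c) (Conj NE \<chi>) \<and> sat t (Neg Bot) \<and> t = t \<inter> c \<union> t"
      by auto
    then show "sat t ?\<phi>" unfolding sat.simps(4) by blast
  qed
  moreover have "?\<phi> \<in> PL_NE" using \<chi>(1) by (intro PL_NE.intros PL.intros)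
  ultimately show ?thesis using \<chi>(2) by (intro bexI[of _ ?\<phi>]) auto
qed

lemma PL_NE_finite_Conj:
  assumes "finite C"
    and "\<And>c. c \<in> C \<Longrightarrow> \<exists>\<phi>\<in>PL_NE. letters \<phi> \<subseteq> X \<and> (\<forall>t\<in>teams X. sat t \<phi> \<longleftrightarrow> R t c)"
  shows "\<exists>\<phi>\<in>PL_NE. letters \<phi> \<subseteq> X \<and> (\<forall>t\<in>teams X. sat t \<phi> \<longleftrightarrow> (\<forall>c\<in>C. R t c))"
  using assms
proof induction
  case empty
  \<comment> \<open>The empty conjunction does occur: no set meets the empty team, so a property
    containing it imposes no meeting conditions.\<close>
  have "Neg Bot \<in> PL_NE" by (intro PL_NE.intros PL.intros)
  then show ?case by force
next
  case (insert c C)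
  obtain \<phi> where \<phi>: "\<phi> \<in> PL_NE" "letters \<phi> \<subseteq> X"
    "\<And>t. t \<in> teams X \<Longrightarrow> sat t \<phi> \<longleftrightarrow> R t c"
    using insert.prems[of c] by auto
  obtain \<psi> where \<psi>: "\<psi> \<in> PL_NE" "letters \<psi> \<subseteq> X"
    "\<And>t. t \<in> teams X \<Longrightarrow> sat t \<psi> \<longleftrightarrow> (\<forall>c\<in>C. R t c)"
    using insert.IH insert.prems by auto
  have "Conj \<phi> \<psi> \<in> PL_NE" using \<phi>(1) \<psi>(1) by (rule PL_NE.intros)
  then show ?case using \<phi>(2,3) \<psi>(2,3) by (intro bexI[of _ "Conj \<phi> \<psi>"]) auto
qed

lemma mem_convex_union_closed_iff:
  assumes "convex_property Q" and "union_closed Q" and "Q \<noteq> {}"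
  shows "t \<in> Q \<longleftrightarrow> t \<subseteq> \<Union>Q \<and> (\<forall>c\<subseteq>\<Union>Q. (\<forall>s\<in>Q. s \<inter> c \<noteq> {}) \<longrightarrow> t \<inter> c \<noteq> {})"
    (is "_ \<longleftrightarrow> ?R")
proof
  assume R: ?R
  have "\<Union>Q \<in> Q" using assms(2,3) by (auto simp: union_closed_def)
  moreover obtain s where "s \<in> Q" "s \<subseteq> t"
  proof (rule ccontr)
    assume "\<not> thesis"
    then have "\<forall>s\<in>Q. s \<inter> (\<Union>Q - t) \<noteq> {}" using that by blast
    then have "t \<inter> (\<Union>Q - t) \<noteq> {}" using R by blast
    then show False by blast
  qed
  \<comment> \<open>Convexity applies to \<open>t\<close> between its subteam \<open>s\<close> and
    the largest team \<open>\<Union>Q\<close>.\<close>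
  ultimately show "t \<in> Q" using R assms(1) unfolding convex_property_def by blast
qed blast

lemma PL_NE_complete:
  assumes "finite X" and "Q \<subseteq> teams X" and "convex_property Q" and "union_closed Q"
  shows "\<exists>\<phi>\<in>PL_NE. letters \<phi> \<subseteq> X \<and> Q = extension X \<phi>"
proof (cases "Q = {}")
  case True
  \<comment> \<open>The empty property is convex and union closed but has no largest team, so it
    gets a contradiction: a team both empty and nonempty.\<close>
  have "Conj Bot NE \<in> PL_NE" by (intro PL_NE.intros)
  then show ?thesis using True by (intro bexI[of _ "Conj Bot NE"]) (auto simp: extension_def)
next
  case False
  \<comment> \<open>The bound \<open>\<Union>Q\<close> keeps each \<open>c\<close> within the finite
    set \<open>valuations X\<close>, so that \<open>C\<close> is finite and its conjunction is a
    formula.\<close>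
  define C where "C = {c. c \<subseteq> \<Union>Q \<and> (\<forall>s\<in>Q. s \<inter> c \<noteq> {})}"
  have m: "\<Union>Q \<subseteq> valuations X" using assms(2) by (auto simp: teams_def)
  have "C \<subseteq> Pow (valuations X)" using m by (auto simp: C_def)
  then have "finite C"
    using finite_valuations[OF assms(1)] finite_subset by blast
  then have "\<exists>\<psi>\<in>PL_NE. letters \<psi> \<subseteq> X \<and>
      (\<forall>t\<in>teams X. sat t \<psi> \<longleftrightarrow> (\<forall>c\<in>C. t \<inter> c \<noteq> {}))"
    using \<open>C \<subseteq> Pow (valuations X)\<close>
    by (intro PL_NE_finite_Conj PL_NE_meets_formula assms(1)) auto
  then obtain \<psi> where \<psi>: "\<psi> \<in> PL_NE" "letters \<psi> \<subseteq> X"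
    "\<And>t. t \<in> teams X \<Longrightarrow> sat t \<psi> \<longleftrightarrow> (\<forall>c\<in>C. t \<inter> c \<noteq> {})"
    by blast
  obtain \<chi> where \<chi>: "\<chi> \<in> PL_NE" "letters \<chi> \<subseteq> X"
    "\<And>t. t \<in> teams X \<Longrightarrow> sat t \<chi> \<longleftrightarrow> t \<subseteq> \<Union>Q"
    using PL_NE_subteam_formula[OF assms(1) m] by blast
  have "t \<in> Q \<longleftrightarrow> t \<in> extension X (Conj \<chi> \<psi>)" for t
  proof -
    have "t \<in> Q \<longleftrightarrow> t \<in> teams X \<and> t \<subseteq> \<Union>Q \<and> (\<forall>c\<in>C. t \<inter> c \<noteq> {})"
      using mem_convex_union_closed_iff[OF assms(3,4) False, of t] assms(2)
      unfolding C_def by blast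
    then show ?thesis using \<chi>(3) \<psi>(3) by (auto simp: extension_def)
  qed
  moreover have "Conj \<chi> \<psi> \<in> PL_NE" using \<chi>(1) \<psi>(1) by (rule PL_NE.intros)
  ultimately show ?thesis using \<chi>(2) \<psi>(2) by (intro bexI[of _ "Conj \<chi> \<psi>"]) auto
qed

theorem theorem3p5:
  fixes P X :: "'p set"
  assumes "countable P" and "infinite P"
    and "finite X" and "X \<subseteq> P"
  shows "{extension X \<phi> |\<phi>. \<phi> \<in> PL_NE \<and> letters \<phi> \<subseteq> X}
       = {Q. Q \<subseteq> teams X \<and> convex_property Q \<and> union_closed Q}"
proof (intro equalityI subsetI)
  fix Q assume "Q \<in> {extension X \<phi> |\<phi>. \<phi> \<in> PL_NE \<and> letters \<phi> \<subseteq> X}"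
  then obtain \<phi> where "Q = extension X \<phi>" by blast
  then show "Q \<in> {Q. Q \<subseteq> teams X \<and> convex_property Q \<and> union_closed Q}"
    using convex_extension union_closed_extension by (auto simp: extension_def)
next
  fix Q assume "Q \<in> {Q. Q \<subseteq> teams X \<and> convex_property Q \<and> union_closed Q}"
  then show "Q \<in> {extension X \<phi> |\<phi>. \<phi> \<in> PL_NE \<and> letters \<phi> \<subseteq> X}"
    using PL_NE_complete[OF assms(3)] by blast
qed

end
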